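(* Let $p>0$, $L>0$, and let $f:\mathbb{R}^k\to\mathbb{R}$ be continuously differentiable and $(L,p)$-Hölder smooth, with $f(x)\ge f^*$ for all $x\in\mathbb{R}^k$, where $f^*\in\mathbb{R}$. Let $0<\alpha<1$ and $K=\frac{L(1-\alpha)}{1+p-\alpha}$. Let $$0<\lambda<\left(\frac1K\right)^{1/p},\qquad 0<\eta<\left(\frac{(1+p)(\lambda^{1-p}-K\lambda)}{L(\lambda^{1-p}+K\lambda)^{1+p}}\right)^{1/p}.$$ Let $x_0\in\mathbb{R}^k$ and for $t\ge0$ let $$x_{t+1}=x_t-\eta\,{}^{C}_{p}\delta^{\alpha}_{c_t}f(x_t),$$ where $c_t\in\mathbb{R}^k$ is any point with $\left|x_t^{(i)}-c_t^{(i)}\right|=\lambda\left|\frac{\partial f}{\partial x^{(i)}}(x_t)\right|^{1/p}$ for $i=1,\dots,k$. Then for every integer $T\ge0$, $$\min_{0\le t\le T}\|\nabla f(x_t)\|_{1+1/p}^{1+1/p}\le\frac{f(x_0)-f^*}{(T+1)\psi},\qquad\text{where}\quad \psi=\eta\left(\lambda^{1-p}-K\lambda-\frac{L}{1+p}\eta^p(\lambda^{1-p}+K\lambda)^{1+p}\right).$$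
   Context: $x^{(i)}$ is the $i$th coordinate of $x\in\mathbb{R}^k$, and $\|\cdot\|_q$ is the $\ell^q$ norm: $\|v\|_q^q=\sum_i|v^{(i)}|^q$. $f:\mathbb{R}^k\to\mathbb{R}$ is $(L,p)$-Hölder smooth if $|f(y)-f(x)-\langle\nabla f(x),y-x\rangle|\le\frac{L}{1+p}\|y-x\|_{1+p}^{1+p}$ for all $x,y$. For $g:\mathbb{R}\to\mathbb{R}$ continuously differentiable, $0<\alpha<1$ and real $x\ne c$, the Caputo derivative is ${}^{C}D^{\alpha}_{c}g(x)=\frac{1}{\Gamma(1-\alpha)}\int_c^x\frac{g'(t)}{|x-t|^{\alpha}}\,dt$ ($\Gamma$ is the gamma function, $\int_c^x$ the oriented integral), and $${}^{C}_{p}\delta^{\alpha}_{c}g(x)=\frac{{}^{C}D^{\alpha}_{c}g(x)\,\Gamma(2-\alpha)}{x-c}|x-c|^{\alpha-p+1}.$$ For $f:\mathbb{R}^k\to\mathbb{R}$ and $x,c\in\mathbb{R}^k$, $${}^{C}_{p}\delta^{\alpha}_{c}f(x)=\big[{}^{C}_{p}\delta^{\alpha}_{c^{(1)}}f_{1,x}(x^{(1)}),\dots,{}^{C}_{p}\delta^{\alpha}_{c^{(k)}}f_{k,x}(x^{(k)})\big],\qquad f_{j,x}(y)=f\big(x+(y-x^{(j)})e^{(j)}\big),$$ where $e^{(j)}$ is the $j$th standard unit vector. In a coordinate where $c^{(j)}=x^{(j)}$ (which in the method happens only when the $j$th partial derivative at $x$ vanishes), that component is read as $0$. *)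

theory Defs
  imports "HOL-Analysis.Analysis"
begin

definition lq_norm :: "real \<Rightarrow> real ^ 'n \<Rightarrow> real" where
  "lq_norm q v = (\<Sum>i\<in>UNIV. \<bar>v $ i\<bar> powr q) powr (1 / q)"

definition coord_fun :: "(real ^ 'n \<Rightarrow> real) \<Rightarrow> 'n \<Rightarrow> real ^ 'n \<Rightarrow> real \<Rightarrow> real" where
  "coord_fun f j x y = f (x + (y - x $ j) *\<^sub>R axis j 1)"

definition partial_deriv :: "(real ^ 'n \<Rightarrow> real) \<Rightarrow> 'n \<Rightarrow> real ^ 'n \<Rightarrow> real" where
  "partial_deriv f j x = deriv (coord_fun f j x) (x $ j)"

definition grad :: "(real ^ 'n \<Rightarrow> real) \<Rightarrow> real ^ 'n \<Rightarrow> real ^ 'n" where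
  "grad f x = (\<chi> j. partial_deriv f j x)"

definition cont_differentiable :: "(real ^ 'n \<Rightarrow> real) \<Rightarrow> bool" where
  "cont_differentiable f \<longleftrightarrow> (\<forall>x. f differentiable (at x)) \<and> continuous_on UNIV (grad f)"

definition holder_smooth :: "real \<Rightarrow> real \<Rightarrow> (real ^ 'n \<Rightarrow> real) \<Rightarrow> bool" where
  "holder_smooth L p f \<longleftrightarrow>
     (\<forall>x y. \<bar>f y - f x - grad f x \<bullet> (y - x)\<bar>
              \<le> L / (1 + p) * lq_norm (1 + p) (y - x) powr (1 + p))"

text \<open>The interval integral is oriented (it changes sign when \<open>x < c\<close>) and is taken over the open
  interval between \<open>c\<close> and \<open>x\<close>, so the singular endpoint \<open>t = x\<close> plays no role.\<close>

definition caputo :: "real \<Rightarrow> real \<Rightarrow> (real \<Rightarrow> real) \<Rightarrow> real \<Rightarrow> real" where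
  "caputo \<alpha> c g x =
     1 / Gamma (1 - \<alpha>) * (LBINT t=ereal c..ereal x. deriv g t / \<bar>x - t\<bar> powr \<alpha>)"

definition caputo_delta :: "real \<Rightarrow> real \<Rightarrow> real \<Rightarrow> (real \<Rightarrow> real) \<Rightarrow> real \<Rightarrow> real" where
  "caputo_delta p \<alpha> c g x =
     caputo \<alpha> c g x * Gamma (2 - \<alpha>) / (x - c) * \<bar>x - c\<bar> powr (\<alpha> - p + 1)"

definition caputo_delta_vec ::
    "real \<Rightarrow> real \<Rightarrow> real ^ 'n \<Rightarrow> (real ^ 'n \<Rightarrow> real) \<Rightarrow> real ^ 'n \<Rightarrow> real ^ 'n" where
  "caputo_delta_vec p \<alpha> c f x =
     (\<chi> j. if c $ j = x $ j then 0 else caputo_delta p \<alpha> (c $ j) (coord_fun f j x) (x $ j))"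

end

theory Submission
  imports Defs
begin

text \<open>
  The method is gradient descent with an inexact direction: the fractional operator is a rescaled
  partial derivative up to a controlled error, and such an error still allows descent.

  The operator sends a function of constant derivative \<open>d\<close> to \<open>d * |x - c| powr (1 - p)\<close>. From a general
  \<open>g\<close> one subtracts the tangent at \<open>x\<close>. Smoothness bounds the remainder \<open>r\<close> by a multiple of
  \<open>|x - t| powr (1 + p)\<close>, but says nothing directly about the derivative of \<open>r\<close>, which is what the Caputo
  integral contains. Integration by parts moves that derivative onto the kernel: the decay of \<open>r\<close> kills
  the boundary term at the singular endpoint and compensates the stronger singularity of the
  differentiated kernel. The resulting error is at most \<open>K * |x - c|\<close>
  (\<open>singular_integral_bound\<close>, \<open>caputo_delta_approx\<close>).

  With \<open>d\<close> the partial derivative, the rule \<open>|x - c| = lam * |d| powr (1 / p)\<close> makes the main term and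
  the error multiples of the same power \<open>|d| powr (1 / p)\<close>, with coefficients \<open>lam powr (1 - p)\<close> and
  \<open>K * lam\<close> (\<open>caputo_direction_approx\<close>). In the smoothness inequality both the first-order gain and the
  penalty are then multiples of the sum of the \<open>|d| powr (1 + 1 / p)\<close>, so each step lowers \<open>f\<close> by at
  least \<open>\<psi>\<close> times the quantity to be minimised (\<open>holder_descent\<close>). The bounds on \<open>lam\<close> and \<open>\<eta>\<close> make
  \<open>\<psi>\<close> positive (\<open>step_constants_pos\<close>), and since \<open>f\<close> can lose at most \<open>f (x 0) - fstar\<close> in total, the
  rate follows by telescoping.
\<close>

section \<open>Integration against the Caputo kernel\<close>

lemma powr_left_endpoint_tendsto_0:
  fixes a x :: real
  assumes "a > 0"
  shows "((\<lambda>t. (x - t) powr a) \<longlongrightarrow> 0) (at_left x)"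
proof -
  have "((\<lambda>t. x - t) \<longlongrightarrow> x - x) (at_left x)"
    by (intro tendsto_intros)
  moreover have "\<forall>\<^sub>F t in at_left x. 0 \<le> x - t"
    by (simp add: eventually_at_filter)
  ultimately have "((\<lambda>t. (x - t) powr a) \<longlongrightarrow> 0 powr a) (at_left x)"
    using assms by (intro tendsto_powr') auto
  then show ?thesis
    by simp
qed

lemma powr_singular_integral:
  fixes c x s :: real
  assumes "c < x" "s > -1"
  shows "set_integrable lborel {c<..<x} (\<lambda>t. (x - t) powr s)"
    and "(LINT t:{c<..<x}|lborel. (x - t) powr s) = (x - c) powr (s + 1) / (s + 1)"
proof -
  define F where "F = (\<lambda>t. - ((x - t) powr (s + 1) / (s + 1)))"
  have D: "DERIV F t :> (x - t) powr s" if "ereal c < ereal t" "ereal t < ereal x" for t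
    unfolding F_def using that assms by (auto intro!: derivative_eq_intros)
  have C: "isCont (\<lambda>t. (x - t) powr s) t" if "ereal c < ereal t" "ereal t < ereal x" for t
    using that by (auto intro!: continuous_intros)
  have "isCont F c"
    unfolding F_def using assms by (auto intro!: continuous_intros)
  then have A: "((F \<circ> real_of_ereal) \<longlongrightarrow> F c) (at_right (ereal c))"
    unfolding ereal_tendsto_simps by (simp add: isCont_def filterlim_at_split)
  have B: "((F \<circ> real_of_ereal) \<longlongrightarrow> 0) (at_left (ereal x))"
    unfolding ereal_tendsto_simps F_def
    using assms
    by (auto intro!: tendsto_eq_intros powr_left_endpoint_tendsto_0 simp: eventually_at_filter)
  have nonneg: "AE t in lborel. ereal c < ereal t \<longrightarrow> ereal t < ereal x \<longrightarrow> 0 \<le> (x - t) powr s"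
    by simp
  have "ereal c < ereal x"
    using assms by simp
  note FTC = interval_integral_FTC_nonneg[OF this D C nonneg A B]
  show "set_integrable lborel {c<..<x} (\<lambda>t. (x - t) powr s)"
    using FTC(1) by simp
  show "(LINT t:{c<..<x}|lborel. (x - t) powr s) = (x - c) powr (s + 1) / (s + 1)"
    using FTC(2) assms by (simp add: interval_lebesgue_integral_le_eq F_def)
qed

text \<open>A continuous factor is bounded on the closed interval, so it does no harm to a weight that is
  singular at an endpoint.\<close>

lemma set_integrable_continuous_mult:
  fixes h w :: "real \<Rightarrow> real"
  assumes w: "set_integrable lborel {c<..<x} w" and h: "continuous_on UNIV h"
  shows "set_integrable lborel {c<..<x} (\<lambda>t. h t * w t)"
proof -
  have "compact (h ` {c..x})"
    by (intro compact_continuous_image continuous_on_subset[OF h]) auto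
  then obtain B where B: "\<And>t. t \<in> {c..x} \<Longrightarrow> \<bar>h t\<bar> \<le> B"
    by (metis bounded_iff compact_imp_bounded imageI real_norm_def)
  have [measurable]: "h \<in> borel_measurable borel"
    using h by (rule borel_measurable_continuous_onI)
  have [measurable]: "(\<lambda>t. indicator {c<..<x} t * w t) \<in> borel_measurable lborel"
    using w unfolding set_integrable_def by (auto dest: borel_measurable_integrable)
  have "(\<lambda>t. h t * (indicator {c<..<x} t * w t)) \<in> borel_measurable lborel"
    by measurable
  then have m: "set_borel_measurable lborel {c<..<x} (\<lambda>t. h t * w t)"
    unfolding set_borel_measurable_def by (simp add: mult.left_commute)
  show ?thesis
  proof (rule set_integrable_bound[OF set_integrable_mult_right[where a = B, OF w] m])
    show "AE t in lborel. t \<in> {c<..<x} \<longrightarrow> norm (h t * w t) \<le> norm (B * w t)"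
    proof (intro always_eventually allI impI)
      fix t assume "t \<in> {c<..<x}"
      then have "\<bar>h t\<bar> \<le> \<bar>B\<bar>"
        using B[of t] by auto
      then show "norm (h t * w t) \<le> norm (B * w t)"
        by (simp add: abs_mult mult_right_mono)
    qed
  qed
qed

text \<open>Integration by parts. The hypothesis bounds \<open>r\<close> but not its derivative \<open>h\<close>, so \<open>h\<close> is traded for
  \<open>r\<close>; the factor \<open>1 + p\<close> disappears because
  \<open>1 + \<alpha> / (1 + p - \<alpha>) = (1 + p) / (1 + p - \<alpha>)\<close>, the two summands being the boundary term at \<open>c\<close>
  and the integral of \<open>r\<close> against the differentiated kernel.\<close>

lemma singular_integral_bound:
  fixes r h :: "real \<Rightarrow> real" and c x \<alpha> p M :: real
  assumes cx: "c < x" and \<alpha>: "0 < \<alpha>" "\<alpha> < 1" and p: "p > 0"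
    and r: "\<And>t. DERIV r t :> h t" and h: "continuous_on UNIV h"
    and bound: "\<And>t. \<bar>r t\<bar> \<le> M / (1 + p) * \<bar>x - t\<bar> powr (1 + p)"
  shows "set_integrable lborel {c<..<x} (\<lambda>t. h t * (x - t) powr (-\<alpha>))"
    and "\<bar>LINT t:{c<..<x}|lborel. h t * (x - t) powr (-\<alpha>)\<bar>
           \<le> M / (1 + p - \<alpha>) * (x - c) powr (1 + p - \<alpha>)"
proof -
  let ?A = "M / (1 + p)"
  \<comment> \<open>\<open>F\<close> has derivative \<open>h t * (x - t) powr (-\<alpha>) + \<alpha> * q t\<close>.\<close>
  define F where "F = (\<lambda>t. r t * (x - t) powr (-\<alpha>))"
  define q where "q = (\<lambda>t. r t * (x - t) powr (-\<alpha> - 1))"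
  have contr: "isCont r t" for t
    using DERIV_isCont[OF r] .
  have bound': "\<bar>r t * (x - t) powr s\<bar> \<le> ?A * (x - t) powr (1 + p + s)" if "t < x" for t s
  proof -
    have "\<bar>r t * (x - t) powr s\<bar> = \<bar>r t\<bar> * (x - t) powr s"
      by (simp add: abs_mult)
    also have "\<dots> \<le> ?A * \<bar>x - t\<bar> powr (1 + p) * (x - t) powr s"
      by (intro mult_right_mono bound) simp
    also have "\<dots> = ?A * (x - t) powr (1 + p + s)"
      using that by (simp add: powr_add)
    finally show ?thesis .
  qed
  have w: "set_integrable lborel {c<..<x} (\<lambda>t. (x - t) powr (-\<alpha>))"
    using powr_singular_integral(1)[OF cx] \<alpha> by auto
  show int_h: "set_integrable lborel {c<..<x} (\<lambda>t. h t * (x - t) powr (-\<alpha>))"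
    using w h by (rule set_integrable_continuous_mult)
  have P: "set_integrable lborel {c<..<x} (\<lambda>t. ?A * (x - t) powr (p - \<alpha>))"
    using powr_singular_integral(1)[OF cx] \<alpha> p by (intro set_integrable_mult_right) auto
  have q_le: "\<bar>q t\<bar> \<le> ?A * (x - t) powr (p - \<alpha>)" if "t < x" for t
    using bound'[OF that, of "-\<alpha> - 1"] by (simp add: q_def)
  have [measurable]: "r \<in> borel_measurable borel"
    using contr by (intro borel_measurable_continuous_onI continuous_at_imp_continuous_on) auto
  have int_q: "set_integrable lborel {c<..<x} q"
  proof (rule set_integrable_bound[OF P])
    show "set_borel_measurable lborel {c<..<x} q"
      unfolding set_borel_measurable_def q_def by measurable
    show "AE t in lborel. t \<in> {c<..<x} \<longrightarrow> norm (q t) \<le> norm (?A * (x - t) powr (p - \<alpha>))"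
      by (intro always_eventually allI impI)
        (metis abs_ge_self greaterThanLessThan_iff order_trans q_le real_norm_def)
  qed
  have int_dF: "set_integrable lborel {c<..<x} (\<lambda>t. h t * (x - t) powr (-\<alpha>) + \<alpha> * q t)"
    using int_h int_q by simp
  have FTC: "(LBINT t=ereal c..ereal x. h t * (x - t) powr (-\<alpha>) + \<alpha> * q t) = 0 - F c"
  proof (rule interval_integral_FTC_integrable)
    show "ereal c < ereal x"
      using cx by simp
    show "set_integrable lborel (einterval (ereal c) (ereal x)) (\<lambda>t. h t * (x - t) powr (-\<alpha>) + \<alpha> * q t)"
      using int_dF by simp
    show "(F has_vector_derivative h t * (x - t) powr (-\<alpha>) + \<alpha> * q t) (at t)"
      if "ereal c < ereal t" "ereal t < ereal x" for t
      unfolding has_real_derivative_iff_has_vector_derivative[symmetric] F_def q_def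
      using that by (auto intro!: derivative_eq_intros r)
    show "isCont (\<lambda>t. h t * (x - t) powr (-\<alpha>) + \<alpha> * q t) t"
      if "ereal c < ereal t" "ereal t < ereal x" for t
      using that h contr unfolding q_def
      by (auto intro!: continuous_intros simp: continuous_on_eq_continuous_at)
    have "isCont F c"
      unfolding F_def using cx by (auto intro!: continuous_intros contr)
    then show "((F \<circ> real_of_ereal) \<longlongrightarrow> F c) (at_right (ereal c))"
      unfolding ereal_tendsto_simps by (simp add: isCont_def filterlim_at_split)
    have "((\<lambda>t. ?A * (x - t) powr (1 + p + (-\<alpha>))) \<longlongrightarrow> ?A * 0) (at_left x)"
      using \<alpha> p by (intro tendsto_intros powr_left_endpoint_tendsto_0) simp
    then have lim: "((\<lambda>t. ?A * (x - t) powr (1 + p + (-\<alpha>))) \<longlongrightarrow> 0) (at_left x)"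
      by simp
    have "(F \<longlongrightarrow> 0) (at_left x)"
      by (rule Lim_null_comparison[OF _ lim])
        (use bound'[of _ "-\<alpha>"] in \<open>auto simp: F_def eventually_at_filter\<close>)
    then show "((F \<circ> real_of_ereal) \<longlongrightarrow> 0) (at_left (ereal x))"
      unfolding ereal_tendsto_simps .
  qed
  have parts: "(LINT t:{c<..<x}|lborel. h t * (x - t) powr (-\<alpha>))
      = - F c - \<alpha> * (LINT t:{c<..<x}|lborel. q t)"
    using FTC cx int_h int_q by (simp add: interval_lebesgue_integral_le_eq)
  have "\<bar>LINT t:{c<..<x}|lborel. q t\<bar> \<le> (LINT t:{c<..<x}|lborel. \<bar>q t\<bar>)"
    using set_integral_norm_bound[OF int_q] by simp
  also have "\<dots> \<le> (LINT t:{c<..<x}|lborel. ?A * (x - t) powr (p - \<alpha>))"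
    using q_le P set_integrable_abs[OF int_q] by (intro set_integral_mono) auto
  also have "\<dots> = ?A * ((x - c) powr (1 + p - \<alpha>) / (1 + p - \<alpha>))"
    using powr_singular_integral(2)[OF cx, of "p - \<alpha>"] \<alpha> p by (simp add: algebra_simps)
  finally have I: "\<bar>LINT t:{c<..<x}|lborel. q t\<bar> \<le> \<dots>" .
  have "\<bar>LINT t:{c<..<x}|lborel. h t * (x - t) powr (-\<alpha>)\<bar>
      \<le> \<bar>F c\<bar> + \<alpha> * \<bar>LINT t:{c<..<x}|lborel. q t\<bar>"
    unfolding parts using \<alpha> abs_triangle_ineq4[of "- F c" "\<alpha> * (LINT t:{c<..<x}|lborel. q t)"]
    by (simp add: abs_mult)
  also have "\<dots> \<le> ?A * (x - c) powr (1 + p - \<alpha>)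
      + \<alpha> * (?A * ((x - c) powr (1 + p - \<alpha>) / (1 + p - \<alpha>)))"
    using bound'[OF cx, of "-\<alpha>"] \<alpha> I by (intro add_mono mult_left_mono) (auto simp: F_def)
  also have "\<dots> = M / (1 + p - \<alpha>) * (x - c) powr (1 + p - \<alpha>)"
  proof -
    have "1 + p - \<alpha> \<noteq> 0" "1 + p \<noteq> 0"
      using \<alpha> p by auto
    then show ?thesis
      by (simp add: divide_simps) (simp add: algebra_simps)
  qed
  finally show "\<bar>LINT t:{c<..<x}|lborel. h t * (x - t) powr (-\<alpha>)\<bar>
      \<le> M / (1 + p - \<alpha>) * (x - c) powr (1 + p - \<alpha>)" .
qed

section \<open>The fractional operator on one coordinate\<close>

lemma Gamma_quotient_caputo:
  fixes \<alpha> :: real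
  assumes "\<alpha> < 1"
  shows "Gamma (2 - \<alpha>) / Gamma (1 - \<alpha>) = 1 - \<alpha>"
proof -
  have "1 - \<alpha> \<notin> \<int>\<^sub>\<le>\<^sub>0"
    using assms by (auto elim!: nonpos_Ints_cases)
  then have "Gamma (1 - \<alpha> + 1) = (1 - \<alpha>) * Gamma (1 - \<alpha>)"
    by (rule Gamma_plus1)
  moreover have "Gamma (1 - \<alpha>) > 0"
    using assms by (intro Gamma_real_pos) simp
  ultimately show ?thesis
    by (simp add: divide_eq_eq)
qed

text \<open>Splitting \<open>g'\<close> into its value at \<open>x\<close> and the derivative of the tangent remainder separates the
  explicit integral of the kernel from the error term.\<close>

lemma caputo_left_bound:
  fixes g :: "real \<Rightarrow> real"
  assumes cx: "c < x" and \<alpha>: "0 < \<alpha>" "\<alpha> < 1" and p: "p > 0"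
    and g: "\<And>t. g differentiable (at t)" and g': "continuous_on UNIV (deriv g)"
    and holder: "\<And>t. \<bar>g t - g x - deriv g x * (t - x)\<bar> \<le> M / (1 + p) * \<bar>t - x\<bar> powr (1 + p)"
  shows "\<bar>caputo \<alpha> c g x * Gamma (2 - \<alpha>) - deriv g x * (x - c) powr (1 - \<alpha>)\<bar>
           \<le> M * (1 - \<alpha>) / (1 + p - \<alpha>) * (x - c) powr (1 + p - \<alpha>)"
proof -
  define r where "r = (\<lambda>t. g t - g x - deriv g x * (t - x))"
  define h where "h = (\<lambda>t. deriv g t - deriv g x)"
  have dg: "DERIV g t :> deriv g t" for t
    using g by (simp add: DERIV_deriv_iff_real_differentiable)
  have r: "DERIV r t :> h t" for t
    unfolding r_def h_def by (auto intro!: derivative_eq_intros dg)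
  have h: "continuous_on UNIV h"
    unfolding h_def by (intro continuous_intros g')
  have b: "\<bar>r t\<bar> \<le> M / (1 + p) * \<bar>x - t\<bar> powr (1 + p)" for t
    using holder[of t] by (simp add: r_def abs_minus_commute)
  note S = singular_integral_bound[OF cx \<alpha> p r h b]
  have "-\<alpha> > -1"
    using \<alpha> by simp
  note W = powr_singular_integral[OF cx this]
  let ?I = "LINT t:{c<..<x}|lborel. h t * (x - t) powr (-\<alpha>)"
  have "(LBINT t=ereal c..ereal x. deriv g t / \<bar>x - t\<bar> powr \<alpha>)
      = (LINT t:{c<..<x}|lborel. h t * (x - t) powr (-\<alpha>) + deriv g x * (x - t) powr (-\<alpha>))"
    using cx
    by (auto simp: interval_lebesgue_integral_le_eq h_def powr_minus field_simps
        intro!: set_lebesgue_integral_cong)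
  also have "\<dots> = ?I + deriv g x * ((x - c) powr (1 - \<alpha>) / (1 - \<alpha>))"
    using S(1) W by simp
  finally have "caputo \<alpha> c g x * Gamma (2 - \<alpha>)
      = Gamma (2 - \<alpha>) / Gamma (1 - \<alpha>) * (?I + deriv g x * ((x - c) powr (1 - \<alpha>) / (1 - \<alpha>)))"
    unfolding caputo_def by simp
  also have "\<dots> = (1 - \<alpha>) * ?I + deriv g x * (x - c) powr (1 - \<alpha>)"
    unfolding Gamma_quotient_caputo[OF \<alpha>(2)] using \<alpha> by (simp add: field_simps)
  finally have "\<bar>caputo \<alpha> c g x * Gamma (2 - \<alpha>) - deriv g x * (x - c) powr (1 - \<alpha>)\<bar>
      = (1 - \<alpha>) * \<bar>?I\<bar>"
    using \<alpha> by (simp add: abs_mult)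
  also have "\<dots> \<le> (1 - \<alpha>) * (M / (1 + p - \<alpha>) * (x - c) powr (1 + p - \<alpha>))"
    using \<alpha> S(2) by (intro mult_left_mono) auto
  finally show ?thesis
    by (simp add: mult_ac)
qed

lemma deriv_reflect:
  fixes g :: "real \<Rightarrow> real"
  assumes "\<And>t. g differentiable (at t)"
  shows "DERIV (\<lambda>u. g (- u)) t :> - deriv g (- t)"
proof -
  have "DERIV g (- t) :> deriv g (- t)"
    using assms by (simp add: DERIV_deriv_iff_real_differentiable)
  then have "DERIV (\<lambda>u. g (- u)) t :> deriv g (- t) * - 1"
    by (rule DERIV_chain2) (auto intro!: derivative_eq_intros)
  then show ?thesis
    by simp
qed

text \<open>Reflection at \<open>0\<close> exchanges the cases \<open>c < x\<close> and \<open>c > x\<close>: the sign of the reflected derivative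
  cancels the reversal of the orientation.\<close>

lemma caputo_reflect:
  fixes g :: "real \<Rightarrow> real"
  assumes "\<And>t. g differentiable (at t)"
  shows "caputo \<alpha> c g x = caputo \<alpha> (- c) (\<lambda>u. g (- u)) (- x)"
proof -
  have "deriv (\<lambda>u. g (- u)) t = - deriv g (- t)" for t
    using deriv_reflect[OF assms] by (rule DERIV_imp_deriv)
  moreover have "(LBINT t=ereal c..ereal x. deriv g t / \<bar>x - t\<bar> powr \<alpha>)
      = (LBINT t=ereal (- x)..ereal (- c). deriv g (- t) / \<bar>x - (- t)\<bar> powr \<alpha>)"
    by (subst interval_integral_reflect) simp
  moreover have "\<bar>x - (- t)\<bar> = \<bar>- x - t\<bar>" for t
    by simp
  ultimately show ?thesis
    unfolding caputo_def
    by (simp add: interval_integral_endpoints_reverse[of "ereal (- x)"]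
        interval_lebesgue_integral_uminus[symmetric])
qed

lemma caputo_delta_reflect:
  fixes g :: "real \<Rightarrow> real"
  assumes "\<And>t. g differentiable (at t)"
  shows "caputo_delta p \<alpha> c g x = - caputo_delta p \<alpha> (- c) (\<lambda>u. g (- u)) (- x)"
proof -
  have "\<bar>- x - - c\<bar> = \<bar>x - c\<bar>" "- x - - c = - (x - c)"
    by simp_all
  then show ?thesis
    unfolding caputo_delta_def caputo_reflect[OF assms, of \<alpha> c x]
    by (simp only: divide_minus_right mult_minus_left minus_minus)
qed

text \<open>For \<open>c < x\<close> the factor \<open>|x - c| powr (\<alpha> - p + 1) / (x - c)\<close> turns the main term \<open>(x - c) powr (1 - \<alpha>)\<close> into
  \<open>(x - c) powr (1 - p)\<close> and the error \<open>(x - c) powr (1 + p - \<alpha>)\<close> into a linear one;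
  the case \<open>c > x\<close> is its mirror image.\<close>

lemma caputo_delta_approx:
  fixes g :: "real \<Rightarrow> real"
  assumes "c \<noteq> x" and \<alpha>: "0 < \<alpha>" "\<alpha> < 1" and p: "p > 0"
    and "\<And>t. g differentiable (at t)" and "continuous_on UNIV (deriv g)"
    and "\<And>t. \<bar>g t - g x - deriv g x * (t - x)\<bar> \<le> M / (1 + p) * \<bar>t - x\<bar> powr (1 + p)"
  shows "\<bar>caputo_delta p \<alpha> c g x - deriv g x * \<bar>x - c\<bar> powr (1 - p)\<bar>
           \<le> M * (1 - \<alpha>) / (1 + p - \<alpha>) * \<bar>x - c\<bar>"
proof -
  have left: "\<bar>caputo_delta p \<alpha> c g x - deriv g x * \<bar>x - c\<bar> powr (1 - p)\<bar>
           \<le> M * (1 - \<alpha>) / (1 + p - \<alpha>) * \<bar>x - c\<bar>"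
    if cx: "c < x" and g: "\<And>t. g differentiable (at t)" and g': "continuous_on UNIV (deriv g)"
      and holder: "\<And>t. \<bar>g t - g x - deriv g x * (t - x)\<bar> \<le> M / (1 + p) * \<bar>t - x\<bar> powr (1 + p)"
    for g :: "real \<Rightarrow> real" and c x
  proof -
    define d where "d = x - c"
    have d: "d > 0"
      using cx by (simp add: d_def)
    have e1: "d powr (\<alpha> - p + 1) / d = d powr (\<alpha> - p)"
      using d by (simp add: powr_add)
    have e2: "d powr (1 - \<alpha>) * d powr (\<alpha> - p) = d powr (1 - p)"
      by (simp add: powr_add[symmetric])
    have e3: "d powr (1 + p - \<alpha>) * d powr (\<alpha> - p) = d"
      using d by (simp add: powr_add[symmetric])
    let ?E = "caputo \<alpha> c g x * Gamma (2 - \<alpha>) - deriv g x * d powr (1 - \<alpha>)"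
    have "caputo_delta p \<alpha> c g x = caputo \<alpha> c g x * Gamma (2 - \<alpha>) * (d powr (\<alpha> - p + 1) / d)"
      unfolding caputo_delta_def using d by (simp add: d_def)
    then have "caputo_delta p \<alpha> c g x - deriv g x * d powr (1 - p) = ?E * d powr (\<alpha> - p)"
      unfolding e1 e2[symmetric] by (simp add: algebra_simps)
    then have "\<bar>caputo_delta p \<alpha> c g x - deriv g x * d powr (1 - p)\<bar> = \<bar>?E\<bar> * d powr (\<alpha> - p)"
      by (simp add: abs_mult)
    also have "\<dots> \<le> M * (1 - \<alpha>) / (1 + p - \<alpha>) * d powr (1 + p - \<alpha>) * d powr (\<alpha> - p)"
      using caputo_left_bound[OF cx \<alpha> p g g' holder]
      by (intro mult_right_mono) (simp_all add: d_def)
    also have "\<dots> = M * (1 - \<alpha>) / (1 + p - \<alpha>) * d"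
      by (simp only: mult.assoc e3)
    finally show ?thesis
      using d by (simp add: d_def)
  qed
  show ?thesis
  proof (cases "c < x")
    case True
    then show ?thesis
      using left assms by blast
  next
    case False
    let ?g = "\<lambda>u. g (- u)"
    have D: "DERIV ?g t :> - deriv g (- t)" for t
      using deriv_reflect assms(5) by blast
    have d: "deriv ?g = (\<lambda>t. - deriv g (- t))"
      using D by (auto intro!: DERIV_imp_deriv)
    have "\<bar>caputo_delta p \<alpha> (-c) ?g (-x) - deriv ?g (-x) * \<bar>- x - - c\<bar> powr (1 - p)\<bar>
           \<le> M * (1 - \<alpha>) / (1 + p - \<alpha>) * \<bar>- x - - c\<bar>"
    proof (rule left)
      show "- c < - x"
        using False assms(1) by simp
      show "?g differentiable (at t)" for t
        using D real_differentiable_def by blast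
      show "continuous_on UNIV (deriv ?g)"
        unfolding d by (intro continuous_intros continuous_on_compose2[OF assms(6)]) auto
      show "\<bar>?g t - ?g (- x) - deriv ?g (- x) * (t - - x)\<bar> \<le> M / (1 + p) * \<bar>t - - x\<bar> powr (1 + p)" for t
      proof -
        have "\<bar>- t - x\<bar> = \<bar>t - - x\<bar>" "deriv g x * (- t - x) = - deriv g x * (t - - x)"
          by (auto simp: algebra_simps)
        then show ?thesis
          using assms(7)[of "- t"] by (simp only: d minus_minus)
      qed
    qed
    moreover have "\<bar>- x - - c\<bar> = \<bar>x - c\<bar>"
      by simp
    moreover have "caputo_delta p \<alpha> c g x - deriv g x * \<bar>x - c\<bar> powr (1 - p)
      = - (caputo_delta p \<alpha> (-c) ?g (-x) - deriv ?g (-x) * \<bar>x - c\<bar> powr (1 - p))"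
      unfolding d caputo_delta_reflect[OF assms(5), of p \<alpha> c x] by simp
    ultimately show ?thesis
      by (simp only: abs_minus_cancel)
  qed
qed

section \<open>Restriction to coordinate lines\<close>

lemma lq_norm_powr:
  assumes "q > 0"
  shows "lq_norm q v powr q = (\<Sum>i\<in>UNIV. \<bar>v $ i\<bar> powr q)"
  using assms by (simp add: lq_norm_def powr_powr sum_nonneg)

text \<open>Points on the same coordinate line have the same restriction of \<open>f\<close>; hence its derivative at any
  parameter is a partial derivative of \<open>f\<close> at the corresponding point of the line.\<close>

lemma coord_fun_rebase:
  "coord_fun f j (x + (t - x $ j) *\<^sub>R axis j 1) = coord_fun f j x"
proof
  fix u
  have "x + (t - x $ j) *\<^sub>R axis j 1 + (u - (x + (t - x $ j) *\<^sub>R axis j 1) $ j) *\<^sub>R axis j 1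
      = x + (u - x $ j) *\<^sub>R axis j (1 :: real)"
    by (simp add: vec_eq_iff axis_def)
  then show "coord_fun f j (x + (t - x $ j) *\<^sub>R axis j 1) u = coord_fun f j x u"
    by (simp only: coord_fun_def)
qed

lemma coord_fun_differentiable:
  fixes f :: "real ^ 'n \<Rightarrow> real"
  assumes "\<And>z. f differentiable (at z)"
  shows "coord_fun f j x differentiable (at t)"
proof -
  have "(f \<circ> (\<lambda>u. x + (u - x $ j) *\<^sub>R axis j 1)) differentiable (at t)"
    by (rule differentiable_chain_at) (use assms in auto)
  then show ?thesis
    by (simp add: coord_fun_def[abs_def] comp_def)
qed

lemma deriv_coord_fun:
  "deriv (coord_fun f j x) t = grad f (x + (t - x $ j) *\<^sub>R axis j 1) $ j"
  by (simp add: grad_def partial_deriv_def coord_fun_rebase)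

lemma deriv_coord_fun_continuous:
  fixes f :: "real ^ 'n \<Rightarrow> real"
  assumes "continuous_on UNIV (grad f)"
  shows "continuous_on UNIV (deriv (coord_fun f j x))"
  unfolding deriv_coord_fun[abs_def]
  by (intro continuous_intros continuous_on_compose2[OF assms]) auto

lemma coord_fun_holder:
  fixes f :: "real ^ 'n \<Rightarrow> real"
  assumes "holder_smooth L p f" and "p > 0"
  shows "\<bar>coord_fun f j x t - coord_fun f j x (x $ j) - deriv (coord_fun f j x) (x $ j) * (t - x $ j)\<bar>
           \<le> L / (1 + p) * \<bar>t - x $ j\<bar> powr (1 + p)"
proof -
  let ?v = "(t - x $ j) *\<^sub>R axis j 1 :: real ^ 'n"
  have "lq_norm (1 + p) ?v powr (1 + p) = (\<Sum>i\<in>UNIV. \<bar>?v $ i\<bar> powr (1 + p))"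
    using assms(2) by (intro lq_norm_powr) simp
  also have "\<dots> = (\<Sum>i\<in>UNIV. if i = j then \<bar>t - x $ j\<bar> powr (1 + p) else 0)"
    using assms(2) by (intro sum.cong) (auto simp: axis_def)
  finally have "lq_norm (1 + p) ?v powr (1 + p) = \<bar>t - x $ j\<bar> powr (1 + p)"
    by simp
  moreover have "grad f x \<bullet> ?v = deriv (coord_fun f j x) (x $ j) * (t - x $ j)"
    by (simp add: inner_axis deriv_coord_fun mult.commute)
  moreover have "coord_fun f j x t = f (x + ?v)" "coord_fun f j x (x $ j) = f x"
    by (simp_all add: coord_fun_def)
  moreover have "\<bar>f (x + ?v) - f x - grad f x \<bullet> (x + ?v - x)\<bar>
      \<le> L / (1 + p) * lq_norm (1 + p) (x + ?v - x) powr (1 + p)"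
    using assms(1) unfolding holder_smooth_def by blast
  ultimately show ?thesis
    by (simp only: add_diff_cancel_left')
qed

section \<open>The descent direction and the rate\<close>

text \<open>The choice of \<open>c\<close> enters here: \<open>d * (|d| powr (1 / p)) powr (1 - p)\<close> has size \<open>|d| powr (1 / p)\<close>,
  the same as \<open>|x - c| / lam\<close>, so that the error of the one-dimensional estimate is a fixed fraction of
  the main term. If the partial derivative is \<open>0\<close> then \<open>c\<close> and \<open>x\<close> agree in this coordinate and
  both terms are \<open>0\<close>.\<close>

lemma caputo_direction_approx:
  fixes f :: "real ^ 'n \<Rightarrow> real" and x c :: "real ^ 'n"
  assumes p: "p > 0" and f: "cont_differentiable f" "holder_smooth L p f"
    and \<alpha>: "0 < \<alpha>" "\<alpha> < 1" and lam: "lam > 0"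
    and c: "\<bar>x $ j - c $ j\<bar> = lam * \<bar>grad f x $ j\<bar> powr (1 / p)"
  shows "\<bar>caputo_delta_vec p \<alpha> c f x $ j
            - lam powr (1 - p) * (sgn (grad f x $ j) * \<bar>grad f x $ j\<bar> powr (1 / p))\<bar>
           \<le> L * (1 - \<alpha>) / (1 + p - \<alpha>) * lam * \<bar>grad f x $ j\<bar> powr (1 / p)"
proof (cases "grad f x $ j = 0")
  case True
  then show ?thesis
    using c by (simp add: caputo_delta_vec_def)
next
  case False
  let ?d = "grad f x $ j"
  have neq: "c $ j \<noteq> x $ j"
    using c False lam by auto
  have d: "deriv (coord_fun f j x) (x $ j) = ?d"
    by (simp add: deriv_coord_fun)
  have "?d * \<bar>x $ j - c $ j\<bar> powr (1 - p) = lam powr (1 - p) * (sgn ?d * (\<bar>?d\<bar> * \<bar>?d\<bar> powr ((1 - p) / p)))"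
    unfolding c using lam by (simp add: powr_mult powr_powr sgn_mult_abs mult.assoc[symmetric])
  also have "\<bar>?d\<bar> * \<bar>?d\<bar> powr ((1 - p) / p) = \<bar>?d\<bar> powr (1 + (1 - p) / p)"
    using False by (simp add: powr_add)
  also have "1 + (1 - p) / p = 1 / p"
    using p by (simp add: field_simps)
  finally have "?d * \<bar>x $ j - c $ j\<bar> powr (1 - p)
      = lam powr (1 - p) * (sgn ?d * \<bar>?d\<bar> powr (1 / p))" .
  moreover have "\<bar>caputo_delta p \<alpha> (c $ j) (coord_fun f j x) (x $ j)
       - deriv (coord_fun f j x) (x $ j) * \<bar>x $ j - c $ j\<bar> powr (1 - p)\<bar>
      \<le> L * (1 - \<alpha>) / (1 + p - \<alpha>) * \<bar>x $ j - c $ j\<bar>"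
    using f p unfolding cont_differentiable_def
    by (intro caputo_delta_approx neq \<alpha> p coord_fun_differentiable deriv_coord_fun_continuous
        coord_fun_holder) auto
  ultimately show ?thesis
    using neq unfolding d by (simp add: caputo_delta_vec_def c mult.assoc)
qed

lemma approx_direction_bounds:
  fixes d D a b p :: real
  assumes "\<bar>D - a * (sgn d * \<bar>d\<bar> powr (1 / p))\<bar> \<le> b * \<bar>d\<bar> powr (1 / p)" and "a \<ge> 0"
  shows "(a - b) * \<bar>d\<bar> powr (1 + 1 / p) \<le> d * D"
    and "\<bar>D\<bar> \<le> (a + b) * \<bar>d\<bar> powr (1 / p)"
proof -
  let ?G = "\<bar>d\<bar> powr (1 / p)"
  let ?e = "D - a * (sgn d * ?G)"
  have *: "\<bar>d\<bar> powr (1 + 1 / p) = \<bar>d\<bar> * ?G"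
    by (cases "d = 0") (simp_all add: powr_add)
  have "\<bar>d * ?e\<bar> \<le> \<bar>d\<bar> * (b * ?G)"
    unfolding abs_mult using assms(1) by (intro mult_left_mono) auto
  moreover have "d * D = a * ((d * sgn d) * ?G) + d * ?e"
    by (simp add: algebra_simps)
  then have "d * D = a * (\<bar>d\<bar> * ?G) + d * ?e"
    by (simp only: abs_sgn[of d])
  ultimately show "(a - b) * \<bar>d\<bar> powr (1 + 1 / p) \<le> d * D"
    unfolding * left_diff_distrib abs_le_iff by (simp add: mult_ac)
  have "\<bar>a * (sgn d * ?G)\<bar> \<le> a * ?G"
    using assms(2) by (simp add: abs_mult abs_sgn_eq)
  then show "\<bar>D\<bar> \<le> (a + b) * ?G"
    using assms(1) by (simp add: algebra_simps)
qed

text \<open>The exponents \<open>1 + p\<close> and \<open>1 + 1 / p\<close> are conjugate: the \<open>1 + p\<close> power of the size bound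
  \<open>S * |d| powr (1 / p)\<close> is a multiple of \<open>|d| powr (1 + 1 / p)\<close>, as is the lower bound for the
  pairing with the gradient. So the smoothness penalty and the first-order gain can be compared
  through their coefficients alone.\<close>

lemma holder_descent:
  fixes f :: "real ^ 'n \<Rightarrow> real" and x D :: "real ^ 'n"
  assumes p: "p > 0" and L: "L > 0" and f: "holder_smooth L p f" and \<eta>: "\<eta> > 0"
    and lower: "\<And>i. m * \<bar>grad f x $ i\<bar> powr (1 + 1 / p) \<le> grad f x $ i * D $ i"
    and upper: "\<And>i. \<bar>D $ i\<bar> \<le> S * \<bar>grad f x $ i\<bar> powr (1 / p)" and S: "S \<ge> 0"
  shows "f (x - \<eta> *\<^sub>R D) \<le> f x - \<eta> * (m - L / (1 + p) * \<eta> powr p * S powr (1 + p))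
           * lq_norm (1 + 1 / p) (grad f x) powr (1 + 1 / p)"
proof -
  let ?N = "\<Sum>i\<in>UNIV. \<bar>grad f x $ i\<bar> powr (1 + 1 / p)"
  have N: "lq_norm (1 + 1 / p) (grad f x) powr (1 + 1 / p) = ?N"
    using p by (intro lq_norm_powr) (simp add: add_pos_pos)
  have "m * ?N \<le> grad f x \<bullet> D"
    unfolding inner_vec_def sum_distrib_left using lower by (intro sum_mono) simp
  then have first: "grad f x \<bullet> (- (\<eta> *\<^sub>R D)) \<le> - (\<eta> * (m * ?N))"
    using \<eta> by simp
  have "lq_norm (1 + p) (- (\<eta> *\<^sub>R D)) powr (1 + p) = (\<Sum>i\<in>UNIV. \<bar>\<eta> * D $ i\<bar> powr (1 + p))"
    using p by (subst lq_norm_powr) auto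
  also have "\<dots> \<le> (\<Sum>i\<in>UNIV. \<eta> powr (1 + p) * S powr (1 + p) * \<bar>grad f x $ i\<bar> powr (1 + 1 / p))"
  proof (rule sum_mono)
    fix i
    have "\<bar>\<eta> * D $ i\<bar> powr (1 + p) \<le> (\<eta> * (S * \<bar>grad f x $ i\<bar> powr (1 / p))) powr (1 + p)"
      using \<eta> p upper[of i] by (intro powr_mono2) (auto simp: abs_mult)
    also have "\<dots> = \<eta> powr (1 + p) * S powr (1 + p) * \<bar>grad f x $ i\<bar> powr (1 / p * (1 + p))"
      using \<eta> S by (simp add: powr_mult powr_powr mult.assoc)
    also have "1 / p * (1 + p) = 1 + 1 / p"
      using p by (simp add: field_simps)
    finally show "\<bar>\<eta> * D $ i\<bar> powr (1 + p)
        \<le> \<eta> powr (1 + p) * S powr (1 + p) * \<bar>grad f x $ i\<bar> powr (1 + 1 / p)" .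
  qed
  also have "\<dots> = \<eta> * \<eta> powr p * S powr (1 + p) * ?N"
    using \<eta> by (simp add: powr_add sum_distrib_left)
  finally have second: "L / (1 + p) * lq_norm (1 + p) (- (\<eta> *\<^sub>R D)) powr (1 + p)
      \<le> L / (1 + p) * (\<eta> * \<eta> powr p * S powr (1 + p) * ?N)"
    using L p by (intro mult_left_mono) auto
  have "\<bar>f (x - \<eta> *\<^sub>R D) - f x - grad f x \<bullet> (x - \<eta> *\<^sub>R D - x)\<bar>
      \<le> L / (1 + p) * lq_norm (1 + p) (x - \<eta> *\<^sub>R D - x) powr (1 + p)"
    using f unfolding holder_smooth_def by blast
  moreover have "x - \<eta> *\<^sub>R D - x = - (\<eta> *\<^sub>R D)"
    by simp
  ultimately have "f (x - \<eta> *\<^sub>R D) \<le> f x + grad f x \<bullet> (- (\<eta> *\<^sub>R D))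
      + L / (1 + p) * lq_norm (1 + p) (- (\<eta> *\<^sub>R D)) powr (1 + p)"
    by (simp only:)
  also have "\<dots> \<le> f x + - (\<eta> * (m * ?N)) + L / (1 + p) * (\<eta> * \<eta> powr p * S powr (1 + p) * ?N)"
    using first second by linarith
  also have "\<dots> = f x - \<eta> * (m - L / (1 + p) * \<eta> powr p * S powr (1 + p)) * ?N"
    by (simp add: algebra_simps)
  finally show ?thesis
    unfolding N .
qed

lemma Min_le_average_decrease:
  fixes a u :: "nat \<Rightarrow> real"
  assumes step: "\<And>t. u (Suc t) \<le> u t - \<psi> * a t" and low: "\<And>t. m \<le> u t" and \<psi>: "\<psi> > 0"
  shows "Min (a ` {0..T}) \<le> (u 0 - m) / (real (T + 1) * \<psi>)"
proof -
  have "\<psi> * (\<Sum>t<n. a t) \<le> u 0 - u n" for n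
  proof (induction n)
    case (Suc n)
    then show ?case
      using step[of n] by (simp add: distrib_left)
  qed simp
  from this[of "Suc T"] have total: "\<psi> * (\<Sum>t<Suc T. a t) \<le> u 0 - m"
    using low[of "Suc T"] by linarith
  have "(\<Sum>t<Suc T. Min (a ` {0..T})) \<le> (\<Sum>t<Suc T. a t)"
    by (intro sum_mono Min_le) auto
  then have "real (T + 1) * Min (a ` {0..T}) \<le> (\<Sum>t<Suc T. a t)"
    by simp
  then have "\<psi> * (real (T + 1) * Min (a ` {0..T})) \<le> \<psi> * (\<Sum>t<Suc T. a t)"
    using \<psi> by (intro mult_left_mono) auto
  with total have "Min (a ` {0..T}) * (real (T + 1) * \<psi>) \<le> u 0 - m"
    by (simp only: mult_ac)
  then show ?thesis
    using \<psi> by (subst pos_le_divide_eq) auto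
qed

text \<open>The bound on \<open>lam\<close> is \<open>K * lam < lam powr (1 - p)\<close> in disguise, which makes the first-order gain
  positive; the bound on \<open>\<eta>\<close> keeps the penalty below that gain.\<close>

lemma step_constants_pos:
  fixes p L K lam \<eta> :: real
  assumes "p > 0" "L > 0" "K > 0" "lam > 0" "lam < (1 / K) powr (1 / p)" "\<eta> > 0"
    and "\<eta> < ((1 + p) * (lam powr (1 - p) - K * lam)
                / (L * (lam powr (1 - p) + K * lam) powr (1 + p))) powr (1 / p)"
  shows "0 < lam powr (1 - p) - K * lam
                - L / (1 + p) * \<eta> powr p * (lam powr (1 - p) + K * lam) powr (1 + p)"
proof -
  have root: "y powr p < z" if "0 < y" "y < z powr (1 / p)" "0 \<le> z" for y z
  proof -
    have "y powr p < (z powr (1 / p)) powr p"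
      using that assms(1) by (intro powr_less_mono2) auto
    then show ?thesis
      using that assms(1) by (simp add: powr_powr)
  qed
  define m where "m = lam powr (1 - p) - K * lam"
  define S where "S = (lam powr (1 - p) + K * lam) powr (1 + p)"
  have "lam powr p < 1 / K"
    using assms by (intro root) auto
  then have "K * lam powr p < 1"
    using assms by (simp add: field_simps)
  then have "lam powr (1 - p) * (K * lam powr p) < lam powr (1 - p) * 1"
    using assms by (intro mult_strict_left_mono) auto
  moreover have "lam powr (1 - p) * (K * lam powr p) = K * lam"
    using assms by (simp add: mult.left_commute powr_add[symmetric])
  ultimately have m: "m > 0"
    by (simp add: m_def)
  have "lam powr (1 - p) + K * lam > 0"
    using assms by (simp add: add_pos_pos)
  then have S: "S > 0"
    by (simp add: S_def)
  have "\<eta> powr p < (1 + p) * m / (L * S)"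
    using assms m S unfolding m_def[symmetric] S_def[symmetric] by (intro root) auto
  then have "L / (1 + p) * \<eta> powr p * S < m"
    using assms S by (simp add: field_simps)
  then show ?thesis
    by (simp add: m_def S_def)
qed

theorem theorem6p2:
  fixes f :: "real ^ 'n \<Rightarrow> real"
    and p L fstar \<alpha> K lam \<eta> \<psi> :: real
    and x c :: "nat \<Rightarrow> real ^ 'n"
    and T :: nat
  assumes "p > 0" and "L > 0"
    and "cont_differentiable f"
    and "holder_smooth L p f"
    and "\<And>y. f y \<ge> fstar"
    and "0 < \<alpha>" and "\<alpha> < 1"
    and "K = L * (1 - \<alpha>) / (1 + p - \<alpha>)"
    and "0 < lam" and "lam < (1 / K) powr (1 / p)"
    and "0 < \<eta>"
    and "\<eta> < ((1 + p) * (lam powr (1 - p) - K * lam)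
                / (L * (lam powr (1 - p) + K * lam) powr (1 + p))) powr (1 / p)"
    and "\<And>t i. \<bar>x t $ i - c t $ i\<bar> = lam * \<bar>partial_deriv f i (x t)\<bar> powr (1 / p)"
    and "\<And>t. x (Suc t) = x t - \<eta> *\<^sub>R caputo_delta_vec p \<alpha> (c t) f (x t)"
    and "\<psi> = \<eta> * (lam powr (1 - p) - K * lam
                - L / (1 + p) * \<eta> powr p * (lam powr (1 - p) + K * lam) powr (1 + p))"
  shows "Min ((\<lambda>t. lq_norm (1 + 1 / p) (grad f (x t)) powr (1 + 1 / p)) ` {0..T})
           \<le> (f (x 0) - fstar) / (real (T + 1) * \<psi>)"
proof (rule Min_le_average_decrease)
  have K: "K > 0"
    using assms by simp
  show "\<psi> > 0"
    unfolding assms(15) using assms K by (intro mult_pos_pos step_constants_pos) auto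
  show "fstar \<le> f (x t)" for t
    by (rule assms)
  show "f (x (Suc t)) \<le> f (x t) - \<psi> * lq_norm (1 + 1 / p) (grad f (x t)) powr (1 + 1 / p)" for t
  proof -
    let ?D = "caputo_delta_vec p \<alpha> (c t) f (x t)"
    have approx: "\<bar>?D $ i - lam powr (1 - p) * (sgn (grad f (x t) $ i) * \<bar>grad f (x t) $ i\<bar> powr (1 / p))\<bar>
        \<le> K * lam * \<bar>grad f (x t) $ i\<bar> powr (1 / p)" for i
      unfolding assms(8) using assms(13)[of t i]
      by (intro caputo_direction_approx assms(1,3,4,6,7,9)) (simp add: grad_def)
    show ?thesis
      unfolding assms(14)[of t] assms(15)
      using K \<open>0 < lam\<close>
      by (intro holder_descent assms(1,2,4,11) approx_direction_bounds[OF approx]) auto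
  qed
qed

end
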